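(* Let $S$ be a finite set of size $k \geqslant 2$, let $n \geqslant 2$ be an integer, and let $M_n$ be a multinomially distributed random variable with $n$ trials and all $k$ probabilities equal to $1/k$ (equivalently, the empirical distribution on $S$ of $n$ independent uniform samples from $S$). Set $\mu \coloneqq n/k$, let $[\mu]$ denote the nearest integer to $\mu$ (ties broken arbitrarily), let $\theta \in \mathbb{R}_{>0}$, and put $$B \coloneqq \left\lfloor n\sqrt{2\theta} + k\,|\mu - [\mu]| \right\rfloor.$$ For any integer $\Delta$ with $0 < \Delta < [\mu]$, define $$c_\Delta \coloneqq \frac{1}{2} + \frac{[\mu]}{\Delta} + \frac{[\mu]^2}{\Delta^2} \log\!\left(1 - \frac{\Delta}{[\mu]} \right).$$ Then for all $\theta$ such that $0 < B < [\mu]$ and $2c_B > -\dfrac{2[\mu]-1}{2[\mu]+1}$, we have \begin{align*} \mathbb{P}\Big(D_{\mathrm{KL}}\big(M_n \parallel \mathrm{Unif}(S)\big) \leqslant \theta\Big) \,<\,{}& \frac{\sqrt{2\pi n} \,\mu^n}{(2\pi[\mu])^{\frac{k}{2}} [\mu]^n} e^{\frac{1}{12n} + k([\mu] - \mu)(1 + \frac{1}{2[\mu]})} \sum_{\Delta = 1}^B \exp\!\Bigg[ \frac{\frac{1}{2} - c_\Delta}{[\mu]^2}\Delta^3 - \left(\frac{\tfrac{1}{2} + c_\Delta}{[\mu]} - \frac{\tfrac{1}{2} - c_\Delta}{2[\mu]^2}\right)\!\Delta \Bigg] \sum_{r=1}^{k} \binom{k}{r} \binom{\Delta - 1}{r -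 1} 2^r \\ &+ \frac{1}{k^n} \begin{cases} \dfrac{n!}{(\mu!)^k} & \text{if } \mu \in \mathbb{Z}, \\ 0 & \text{otherwise.} \end{cases} \end{align*}
   Context: For probability mass functions $\mathfrak{p},\mathfrak{q}$ on a finite set $S$, the relative entropy (Kullback--Leibler divergence) is $D_{\mathrm{KL}}(\mathfrak{p}\parallel\mathfrak{q}) = \sum_{a\in S} \mathfrak{p}(a)\log\frac{\mathfrak{p}(a)}{\mathfrak{q}(a)}$, with the convention $0\log 0 = 0$. $\mathrm{Unif}(S)$ is the uniform distribution on $S$. In $D_{\mathrm{KL}}(M_n \parallel \mathrm{Unif}(S))$, $M_n$ is regarded as the probability distribution on $S$ whose value at $a$ is the number of the $n$ trials landing on $a$ divided by $n$. *)

theory Defs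
  imports "HOL-Probability.Probability"
begin

text \<open>
  The random vector \<open>N\<close> of counts has the multinomial law with \<open>n\<close> trials and cell
  probabilities \<open>p a\<close>, \<open>a \<in> S\<close>.  Only the coordinates in \<open>S\<close> are constrained; values
  of \<open>N\<close> outside \<open>S\<close> are irrelevant.
\<close>
definition multinomially_distributed ::
  "'w measure \<Rightarrow> ('w \<Rightarrow> 'a \<Rightarrow> nat) \<Rightarrow> 'a set \<Rightarrow> nat \<Rightarrow> ('a \<Rightarrow> real) \<Rightarrow> bool" where
  "multinomially_distributed M N S n p \<longleftrightarrow>
     (\<forall>a\<in>S. (\<lambda>\<omega>. N \<omega> a) \<in> measurable M (count_space UNIV)) \<and>
     (\<forall>c :: 'a \<Rightarrow> nat.
        measure M {\<omega> \<in> space M. \<forall>a\<in>S. N \<omega> a = c a} =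
          (if (\<Sum>a\<in>S. c a) = n
           then fact n / (\<Prod>a\<in>S. fact (c a)) * (\<Prod>a\<in>S. p a ^ c a)
           else 0))"

text \<open>
  The convention \<open>0 log 0 = 0\<close> holds automatically.  The formula gives the relative entropy
  whenever \<open>q\<close> is positive on \<open>S\<close>; the value \<open>\<infinity>\<close> for \<open>p a > 0 = q a\<close> is not represented.
\<close>
definition rel_entropy :: "'a set \<Rightarrow> ('a \<Rightarrow> real) \<Rightarrow> ('a \<Rightarrow> real) \<Rightarrow> real" where
  "rel_entropy S p q = (\<Sum>a\<in>S. p a * ln (p a / q a))"

definition empirical :: "nat \<Rightarrow> ('a \<Rightarrow> nat) \<Rightarrow> 'a \<Rightarrow> real" where
  "empirical n c a = real (c a) / real n"

text \<open>
  A relation rather than a function, because a half-integer has two nearest integers.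
\<close>
definition nearest_int :: "real \<Rightarrow> int \<Rightarrow> bool" where
  "nearest_int x m \<longleftrightarrow> (\<forall>j :: int. \<bar>x - of_int m\<bar> \<le> \<bar>x - of_int j\<bar>)"

definition c_coeff :: "real \<Rightarrow> real \<Rightarrow> real" where
  "c_coeff m \<Delta> = 1/2 + m / \<Delta> + m\<^sup>2 / \<Delta>\<^sup>2 * ln (1 - \<Delta> / m)"

end

theory Submission
  imports Defs "HOL-Real_Asymp.Real_Asymp"
begin

text \<open>
  By Pinsker's inequality the event forces the counts \<open>c\<close> to lie within \<open>l\<^sup>1\<close>-distance \<open>B\<close> of the
  constant vector \<open>m\<close>. The integer vectors at distance exactly \<open>\<Delta>\<close> number
  \<open>\<Sum>r. (k choose r) ((\<Delta> - 1) choose (r - 1)) 2\<^sup>r\<close>, by choosing the support of \<open>c - m\<close>, the signs and a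
  composition of \<open>\<Delta>\<close>. Each of them has a multinomial probability that Stirling's formula with
  Robbins' error bounds reduces to \<open>\<Sum>a. (c a + 1/2) ln (c a)\<close>. The coefficient \<open>c\<^sub>\<Delta>\<close> is chosen such
  that the parabola \<open>x - (1/2 - c\<^sub>\<Delta>) x\<^sup>2\<close> meets \<open>ln (1 + x)\<close> at \<open>x = - \<Delta>/m\<close>, and it then lies below
  it for all larger \<open>x\<close>. In the resulting estimate the coefficient of \<open>\<Sum>a. (c a - m)\<^sup>2\<close> is nonnegative
  by the hypothesis on \<open>c\<^sub>B\<close> and the monotonicity of \<open>c\<^sub>\<Delta>\<close> in \<open>\<Delta>\<close>, so this sum may be replaced by \<open>\<Delta>\<close>, and
  \<open>\<Sum>a. (c a - m)\<^sup>3\<close> by \<open>\<Delta>\<^sup>3\<close>.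
\<close>

section \<open>Stirling's formula\<close>

text \<open>The logarithm of n! divided by n^(n + 1/2) e^(-n). The factor sqrt (2 pi) of Stirling's
  formula is left in, so the limit is ln (2 pi) / 2 and not 0.\<close>

definition stirling_err :: "nat \<Rightarrow> real" where
  "stirling_err n = ln (fact n) - (real n + 1/2) * ln (real n) + real n"

lemma stirling_err_diff:
  assumes "n > 0"
  shows "stirling_err n - stirling_err (Suc n) = (real n + 1/2) * ln (1 + 1 / real n) - 1"
proof -
  have *: "1 + 1 / real n = real (Suc n) / real n"
    using assms by (simp add: field_simps)
  have "ln (1 + 1 / real n) = ln (real (Suc n)) - ln (real n)"
    unfolding * using assms by (subst ln_div) auto
  moreover have "ln (fact (Suc n) :: real) = ln (real (Suc n)) + ln (fact n)"
    unfolding fact_Suc of_nat_mult by (subst ln_mult) (auto simp del: of_nat_Suc)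
  ultimately show ?thesis
    by (simp add: stirling_err_def del: fact_Suc) (simp add: field_simps)
qed

text \<open>With y = 1/(2n + 1) one has 1 + 1/n = (1 + y)/(1 - y), whose logarithm is 2 (y + y^3/3 +
  y^5/5 + ...). Dropping all but the first term gives the decrease; dominating the tail by a
  geometric series gives the upper bound, which is written as a difference so that it
  telescopes.\<close>

lemma stirling_err_diff_bounds:
  assumes "n > 0"
  shows "stirling_err (Suc n) < stirling_err n"
    and "stirling_err n - stirling_err (Suc n) \<le> 1 / (12 * real n) - 1 / (12 * real (Suc n))"
proof -
  let ?x = "1 + 1 / real n"
  define y where "y = 1 / (2 * real n + 1)"
  have y: "0 < y" using assms by (simp add: y_def)
  have y_eq: "(?x - 1) / (?x + 1) = y"
    using assms by (simp add: y_def field_simps)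
  have n_eq: "real n + 1/2 = 1 / (2 * y)"
    using assms by (simp add: y_def field_simps)
  have "ln ?x \<ge> 2 * y + 2 * y ^ 3 / 3"
    using ln_approx_bounds[of ?x 2, unfolded y_eq] assms by (simp add: eval_nat_numeral)
  then have "ln ?x > 2 * y"
    using y by (smt (verit) divide_pos_pos mult_pos_pos zero_less_power)
  then have "(real n + 1/2) * ln ?x > 1"
    using y unfolding n_eq by (simp add: field_simps)
  then show "stirling_err (Suc n) < stirling_err n"
    using stirling_err_diff[OF assms] by simp
  have "ln ?x \<le> 2 * y + 2 * (y ^ 3 / (1 - y\<^sup>2) / 3)"
    using ln_approx_bounds[of ?x 1, unfolded y_eq] assms by (simp add: eval_nat_numeral)
  then have "(real n + 1/2) * ln ?x \<le> (real n + 1/2) * (2 * y + 2 * (y ^ 3 / (1 - y\<^sup>2) / 3))"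
    by (intro mult_left_mono) auto
  also have "\<dots> = 1 + y\<^sup>2 / (1 - y\<^sup>2) / 3"
    unfolding n_eq using y by (simp add: field_simps power2_eq_square power3_eq_cube)
  also have "y\<^sup>2 / (1 - y\<^sup>2) / 3 = 1 / (12 * real n * (real n + 1))"
  proof -
    have "1 - y\<^sup>2 = 4 * real n * (real n + 1) * y\<^sup>2"
      using assms by (simp add: y_def divide_simps) (simp add: power2_eq_square algebra_simps)
    then show ?thesis using y by simp
  qed
  also have "1 / (12 * real n * (real n + 1)) = 1 / (12 * real n) - 1 / (12 * real (Suc n))"
    using assms by (simp add: divide_simps) 
  finally show "stirling_err n - stirling_err (Suc n) \<le> 1 / (12 * real n) - 1 / (12 * real (Suc n))"
    using stirling_err_diff[OF assms] by simp
qed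

text \<open>Expresses the partial Wallis products by factorials, so that their limit pi/2 determines
  the constant in Stirling's formula.\<close>

lemma wallis_prod_eq:
  "(\<Prod>k=1..n. (4 * real k ^ 2) / (4 * real k ^ 2 - 1))
     = 2 ^ (4 * n) * fact n ^ 4 / (fact (2 * n) ^ 2 * (2 * real n + 1))"
proof (induction n)
  case (Suc n)
  have 1: "fact (2 * Suc n) = (2 * real n + 2) * (2 * real n + 1) * fact (2 * n)"
    by (simp add: algebra_simps)
  have 2: "4 * real (Suc n) ^ 2 - 1 = (2 * real n + 1) * (2 * real n + 3)"
    by (simp add: power2_eq_square algebra_simps)
  have 3: "2 * real (Suc n) + 1 = 2 * real n + 3" by simp
  have 4: "fact (Suc n) = (real n + 1) * fact n" by (simp add: algebra_simps)
  have 5: "(2::real) ^ (4 * Suc n) = 16 * 2 ^ (4 * n)" by (simp add: power_add)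
  have 6: "4 * real (Suc n) ^ 2 = (2 * real n + 2) ^ 2"
    by (simp add: power2_eq_square algebra_simps)
  define a b where "a = 2 * real n + 1" and "b = 2 * real n + 3"
  have ab: "a > 0" "b > 0" "real n + 1 > 0" by (auto simp: a_def b_def)
  have c: "2 * real n + 2 = 2 * (real n + 1)" by simp
  have "(\<Prod>k=1..Suc n. (4 * real k ^ 2) / (4 * real k ^ 2 - 1))
    = (4 * real (Suc n) ^ 2) / (4 * real (Suc n) ^ 2 - 1)
      * (2 ^ (4 * n) * fact n ^ 4 / (fact (2 * n) ^ 2 * (2 * real n + 1)))"
    by (subst prod.nat_ivl_Suc', simp) (simp only: Suc.IH)
  also have "\<dots> = (2 * (real n + 1)) ^ 2 / (a * b) * (2 ^ (4 * n) * fact n ^ 4 / (fact (2 * n) ^ 2 * a))"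
    unfolding 2 unfolding 6 a_def b_def c ..
  also have "\<dots> = 16 * 2 ^ (4 * n) * ((real n + 1) * fact n) ^ 4 / ((2 * (real n + 1) * a * fact (2 * n)) ^ 2 * b)"
    using ab by (simp add: divide_simps power_mult_distrib power2_eq_square power4_eq_xxxx)
      (simp add: algebra_simps)
  also have "\<dots> = 2 ^ (4 * Suc n) * fact (Suc n) ^ 4 / (fact (2 * Suc n) ^ 2 * (2 * real (Suc n) + 1))"
    unfolding 1 3 4 5 a_def b_def c ..
  finally show ?case .
qed simp

text \<open>The sequence decreases and is bounded below, so it has a limit L. The n-th Wallis
  product is exp (4 \<open>stirling_err n\<close> - 2 \<open>stirling_err (2 * n)\<close>) times a
  factor tending to 1/4; hence exp (2 L) / 4 = pi/2.\<close>

lemma stirling_err_tendsto: "stirling_err \<longlonglongrightarrow> ln (2 * pi) / 2"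
proof -
  let ?s = "\<lambda>n. stirling_err (Suc n)"
  have lower: "stirling_err 1 - 1 / 12 + 1 / (12 * real (Suc n)) \<le> ?s n" for n
  proof (induction n)
    case (Suc n)
    show ?case using Suc stirling_err_diff_bounds(2)[of "Suc n"] by simp
  qed simp
  have "decseq ?s"
    by (rule decseq_SucI) (use stirling_err_diff_bounds(1) in \<open>auto intro: less_imp_le\<close>)
  moreover have "stirling_err 1 - 1 / 12 \<le> ?s n" for n
    using lower[of n] by (smt (verit) divide_nonneg_nonneg of_nat_0_le_iff)
  ultimately obtain L where "?s \<longlonglongrightarrow> L"
    using decseq_convergent by blast
  then have L: "stirling_err \<longlonglongrightarrow> L"
    by (simp add: filterlim_sequentially_Suc)
  have L2: "(\<lambda>n. stirling_err (2 * n)) \<longlonglongrightarrow> L"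
    using LIMSEQ_subseq_LIMSEQ[OF L, of "\<lambda>n. 2 * n"] by (simp add: strict_mono_def o_def)
  have "(\<lambda>n. real n / (2 * (2 * real n + 1))) \<longlonglongrightarrow> 1 / 4"
    by real_asymp
  then have "(\<lambda>n. exp (4 * stirling_err n - 2 * stirling_err (2 * n)) * (real n / (2 * (2 * real n + 1))))
    \<longlonglongrightarrow> exp (4 * L - 2 * L) * (1 / 4)"
    by (rule tendsto_mult[rotated]) (intro tendsto_intros L L2)
  moreover have "eventually (\<lambda>n. exp (4 * stirling_err n - 2 * stirling_err (2 * n)) * (real n / (2 * (2 * real n + 1)))
     = (\<Prod>k=1..n. (4 * real k ^ 2) / (4 * real k ^ 2 - 1))) sequentially"
    using eventually_gt_at_top[of 0]
  proof eventually_elim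
    case (elim n)
    have "ln (2 ^ (4 * n) * fact n ^ 4 / (fact (2 * n) ^ 2 * (2 * real n + 1)))
      = 4 * real n * ln 2 + 4 * ln (fact n) - 2 * ln (fact (2 * n)) - ln (2 * real n + 1)"
      by (simp add: ln_div ln_mult ln_realpow add_nonneg_pos)
    also have "\<dots> = 4 * stirling_err n - 2 * stirling_err (2 * n) + ln (real n) - ln 2 - ln (2 * real n + 1)"
      using elim by (simp add: stirling_err_def ln_mult algebra_simps)
    also have "\<dots> = 4 * stirling_err n - 2 * stirling_err (2 * n) + ln (real n / (2 * (2 * real n + 1)))"
      using elim ln_mult[of 2 "2 * real n + 1"] by (simp add: ln_div)
    finally have "2 ^ (4 * n) * fact n ^ 4 / (fact (2 * n) ^ 2 * (2 * real n + 1))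
      = exp (4 * stirling_err n - 2 * stirling_err (2 * n) + ln (real n / (2 * (2 * real n + 1))))"
      by (subst ln_inj_iff[symmetric]) (auto simp: add_nonneg_pos)
    also have "\<dots> = exp (4 * stirling_err n - 2 * stirling_err (2 * n)) * (real n / (2 * (2 * real n + 1)))"
      using elim by (subst exp_add) simp
    finally show ?case unfolding wallis_prod_eq by simp
  qed
  ultimately have "(\<lambda>n. \<Prod>k=1..n. (4 * real k ^ 2) / (4 * real k ^ 2 - 1)) \<longlonglongrightarrow> exp (4 * L - 2 * L) * (1 / 4)"
    by (rule Lim_transform_eventually)
  then have "exp (2 * L) = 2 * pi"
    using LIMSEQ_unique[OF wallis] by fastforce
  then have "2 * L = ln (2 * pi)" by (metis ln_exp)
  then have "ln (2 * pi) / 2 = L" by simp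
  then show ?thesis using L by (simp only:)
qed

text \<open>Robbins' bounds: \<open>stirling_err n\<close> decreases to its limit, while
  \<open>stirling_err n\<close> - 1/(12 n) increases to the same limit.\<close>

lemma stirling_err_bounds:
  assumes "n > 0"
  shows "ln (2 * pi) / 2 < stirling_err n"
    and "stirling_err n \<le> ln (2 * pi) / 2 + 1 / (12 * real n)"
proof -
  \<comment> \<open>The limit is compared with the term after n, which is strictly smaller than the
    term at n. This makes the lower bound strict, and it is the source of the strict inequality in
    \<open>multinomial_term_bound\<close>.\<close>
  have "decseq (\<lambda>i. stirling_err (i + Suc n))"
    by (rule decseq_SucI) (use stirling_err_diff_bounds(1) in \<open>auto intro: less_imp_le\<close>)
  moreover have "(\<lambda>i. stirling_err (i + Suc n)) \<longlonglongrightarrow> ln (2 * pi) / 2"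
    using LIMSEQ_ignore_initial_segment[OF stirling_err_tendsto, of "Suc n"] .
  ultimately have "ln (2 * pi) / 2 \<le> stirling_err (0 + Suc n)"
    by (rule decseq_ge)
  then show "ln (2 * pi) / 2 < stirling_err n"
    using stirling_err_diff_bounds(1)[OF assms] by simp
next
  let ?t = "\<lambda>i. stirling_err (i + n) - 1 / (12 * real (i + n))"
  have "incseq ?t"
    by (rule incseq_SucI) (use stirling_err_diff_bounds(2)[of "_ + n"] assms in \<open>simp add: algebra_simps\<close>)
  moreover have "(\<lambda>i. 1 / (12 * real (i + n))) \<longlonglongrightarrow> 0"
    by real_asymp
  then have "?t \<longlonglongrightarrow> ln (2 * pi) / 2 - 0"
    by (intro tendsto_diff LIMSEQ_ignore_initial_segment[OF stirling_err_tendsto])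
  ultimately have "?t 0 \<le> ln (2 * pi) / 2 - 0"
    by (rule incseq_le)
  then show "stirling_err n \<le> ln (2 * pi) / 2 + 1 / (12 * real n)"
    by simp
qed

section \<open>Parabolic bound for the logarithm\<close>

text \<open>The difference F of the two sides vanishes at 0 and at -y. Its derivative t (2A - 1/(1 +
  t)) has, besides 0, only the zero 1/(2A) - 1, which is at most 0 because A >= 1/2. To the right of
  -y, F increases up to that zero, decreases from there to 0 and increases afterwards; on each piece
  it is compared with one of its two known zeros.\<close>

lemma ln_ge_parabola:
  fixes A x y :: real
  assumes "0 < y" "y < 1" and A: "ln (1 - y) = - y - A * y\<^sup>2" and "- y \<le> x"
  shows "x - A * x\<^sup>2 \<le> ln (1 + x)"
proof -
  define F where "F = (\<lambda>t. ln (1 + t) - t + A * t\<^sup>2)"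
  have F0: "F 0 = 0" by (simp add: F_def)
  have Fy: "F (- y) = 0" using A by (simp add: F_def)
  have F': "DERIV F t :> t * (2 * A - 1 / (1 + t))" if "- 1 < t" for t
    unfolding F_def using that
    by (auto intro!: derivative_eq_intros simp: field_simps)
  \<comment> \<open>Compared with the assumption on A, this yields A >= 1/2.\<close>
  have half: "ln (1 - y) \<le> - y - y\<^sup>2 / 2"
  proof -
    have "(\<lambda>t. ln (1 - t) + t + t\<^sup>2 / 2) y \<le> (\<lambda>t. ln (1 - t) + t + t\<^sup>2 / 2) 0"
    proof (rule DERIV_nonpos_imp_nonincreasing[of 0 y "\<lambda>t. ln (1 - t) + t + t\<^sup>2 / 2"])
      fix t assume t: "0 \<le> t" "t \<le> y"
      have "DERIV (\<lambda>t. ln (1 - t) + t + t\<^sup>2 / 2) t :> - 1 / (1 - t) + 1 + t"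
        using t assms by (auto intro!: derivative_eq_intros)
      moreover have "- 1 / (1 - t) + 1 + t \<le> 0"
        using t assms by (simp add: field_simps)
      ultimately show "\<exists>d. DERIV (\<lambda>t. ln (1 - t) + t + t\<^sup>2 / 2) t :> d \<and> d \<le> 0"
        by blast
    qed (use assms in simp)
    then show ?thesis by simp
  qed
  then have "y\<^sup>2 / 2 \<le> A * y\<^sup>2" using A by simp
  then have A12: "1 / 2 \<le> A"
    using \<open>0 < y\<close> by (simp add: field_simps)
  consider "0 \<le> x" | "x < 0" "2 * A * (1 + x) \<le> 1" | "x < 0" "2 * A * (1 + x) > 1"
    by linarith
  then have "0 \<le> F x"
  proof cases
    case 1
    have "F 0 \<le> F x"
    proof (rule DERIV_nonneg_imp_nondecreasing[OF 1])
      fix t assume t: "0 \<le> t" "t \<le> x"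
      have "1 / (1 + t) \<le> 1" using t by simp
      then have "1 / (1 + t) \<le> 2 * A" using A12 by linarith
      then have "0 \<le> t * (2 * A - 1 / (1 + t))" using t by (intro mult_nonneg_nonneg) auto
      then show "\<exists>d. DERIV F t :> d \<and> d \<ge> 0" using F'[of t] t by force
    qed
    then show ?thesis using F0 by simp
  next
    case 2
    have "F (- y) \<le> F x"
    proof (rule DERIV_nonneg_imp_nondecreasing[OF \<open>- y \<le> x\<close>])
      fix t assume t: "- y \<le> t" "t \<le> x"
      have "2 * A * (1 + t) \<le> 2 * A * (1 + x)" using t A12 by (intro mult_left_mono) auto
      then have "2 * A \<le> 1 / (1 + t)" using 2 t assms by (simp add: field_simps)
      then have "0 \<le> t * (2 * A - 1 / (1 + t))" using t 2 by (intro mult_nonpos_nonpos) auto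
      then show "\<exists>d. DERIV F t :> d \<and> d \<ge> 0" using F'[of t] t assms by force
    qed
    then show ?thesis using Fy by simp
  next
    case 3
    have "F 0 \<le> F x"
    proof (rule DERIV_nonpos_imp_nonincreasing[of x 0 F])
      fix t assume t: "x \<le> t" "t \<le> 0"
      have "2 * A * (1 + x) \<le> 2 * A * (1 + t)" using t A12 by (intro mult_left_mono) auto
      then have "1 / (1 + t) \<le> 2 * A" using 3 t assms by (simp add: field_simps)
      then have "t * (2 * A - 1 / (1 + t)) \<le> 0" using t by (intro mult_nonpos_nonneg) auto
      then show "\<exists>d. DERIV F t :> d \<and> d \<le> 0" using F'[of t] t assms by force
    qed (use 3 in simp)
    then show ?thesis using F0 by simp
  qed
  then show ?thesis by (simp add: F_def)
qed

text \<open>The definition of \<open>c_coeff\<close> solved for the logarithm, in the form that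
  \<open>ln_ge_parabola\<close> expects with y = D/m and A = 1/2 -
  \<open>c_coeff m D\<close>.\<close>

lemma ln_one_minus_eq_c_coeff:
  assumes "0 < D" "0 < m"
  shows "ln (1 - D / m) = - (D / m) - (1/2 - c_coeff m D) * (D / m)\<^sup>2"
  using assms by (simp add: c_coeff_def field_simps power2_eq_square)

text \<open>The parabola that meets the logarithm at -B/m lies below it at -D/m, where the parabola
  belonging to D meets it. Comparing the two quadratic coefficients there gives the claim.\<close>

lemma c_coeff_antimono:
  assumes "0 < D" "D \<le> B" "B < m"
  shows "c_coeff m B \<le> c_coeff m D"
proof -
  have "- (D / m) - (1/2 - c_coeff m B) * (- (D / m))\<^sup>2 \<le> ln (1 + - (D / m))"
    using assms
    by (intro ln_ge_parabola[where y = "B / m"] ln_one_minus_eq_c_coeff) (auto simp: divide_right_mono)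
  also have "\<dots> = - (D / m) - (1/2 - c_coeff m D) * (D / m)\<^sup>2"
    using ln_one_minus_eq_c_coeff[of D m] assms by simp
  finally have "(1/2 - c_coeff m D) * (D / m)\<^sup>2 \<le> (1/2 - c_coeff m B) * (D / m)\<^sup>2"
    by simp
  then show ?thesis using assms by (simp add: mult_le_cancel_right)
qed

lemma c_coeff_le_half:
  assumes "0 < D" "D < m"
  shows "c_coeff m D \<le> 1/2"
proof -
  have "ln (1 - D / m) \<le> - (D / m)"
    using assms by (intro ln_one_minus_pos_upper_bound) auto
  then have "0 \<le> (1/2 - c_coeff m D) * (D / m)\<^sup>2"
    using ln_one_minus_eq_c_coeff[of D m] assms by simp
  then show ?thesis using assms by (simp add: zero_le_mult_iff)
qed

section \<open>Pinsker's inequality\<close>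

text \<open>The difference h of the two sides vanishes at 1, and h' has the sign of t - 1, since ln
  t lies on the far side of 2 (t - 1)/(t + 1) from 0. At x = 0 the term \<open>x * ln x\<close> is 0
  and the claim reads 3 <= 4.\<close>

lemma square_le_entropy_kernel:
  fixes x :: real
  assumes "0 \<le> x"
  shows "3 * (x - 1)\<^sup>2 \<le> (4 + 2 * x) * (x * ln x - x + 1)"
proof (cases "x = 0")
  case False
  with assms have x: "0 < x" by simp
  define h where "h = (\<lambda>t. (4 + 2 * t) * (t * ln t - t + 1) - 3 * (t - 1)\<^sup>2 :: real)"
  have h1: "h 1 = 0" by (simp add: h_def)
  have h': "DERIV h t :> 4 * ((t + 1) * ln t - 2 * (t - 1))" if "0 < t" for t
    unfolding h_def using that
    by (auto intro!: derivative_eq_intros simp: field_simps)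
  have "h 1 \<le> h x"
  proof (cases "1 \<le> x")
    case True
    show ?thesis
    proof (rule DERIV_nonneg_imp_nondecreasing[OF True])
      fix t assume t: "1 \<le> t" "t \<le> x"
      have "2 * (t - 1) \<le> (t + 1) * ln t"
      proof (cases "t = 1")
        case False
        then show ?thesis using ln_inverse_approx_ge[of 1 t] t by (simp add: field_simps)
      qed simp
      then show "\<exists>d. DERIV h t :> d \<and> d \<ge> 0" using h'[of t] t by force
    qed
  next
    case False
    show ?thesis
    proof (rule DERIV_nonpos_imp_nonincreasing[of x 1 h])
      fix t assume t: "x \<le> t" "t \<le> 1"
      have "(t + 1) * ln t \<le> 2 * (t - 1)"
      proof (cases "t = 1")
        case False
        then show ?thesis using ln_inverse_approx_ge[of t 1] t x by (simp add: field_simps)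
      qed simp
      then show "\<exists>d. DERIV h t :> d \<and> d \<le> 0" using h'[of t] t x by force
    qed (use False in simp)
  qed
  then show ?thesis using h1 by (simp add: h_def)
qed simp

text \<open>Cauchy--Schwarz with the weights \<open>(4 + 2x)/3\<close>, whose \<open>q\<close>-mean is \<open>2\<close>.\<close>
lemma pinsker:
  fixes p q :: "'a \<Rightarrow> real"
  assumes q: "\<And>a. a \<in> S \<Longrightarrow> 0 < q a" and p: "\<And>a. a \<in> S \<Longrightarrow> 0 \<le> p a"
    and sums: "(\<Sum>a\<in>S. p a) = 1" "(\<Sum>a\<in>S. q a) = 1"
  shows "(\<Sum>a\<in>S. \<bar>p a - q a\<bar>)\<^sup>2 \<le> 2 * rel_entropy S p q"
proof -
  define x where "x a = p a / q a" for a
  define w where "w a = (4 + 2 * x a) / 3" for a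
  \<comment> \<open>The added - x + 1 makes the summand nonnegative at every point, as the square
    root below requires, and does not change the \<open>q\<close>-mean because \<open>p\<close> and
    \<open>q\<close> have equal totals.\<close>
  define v where "v a = x a * ln (x a) - x a + 1" for a
  have x: "0 \<le> x a" if "a \<in> S" for a using p[OF that] q[OF that] by (simp add: x_def)
  have px: "p a = q a * x a" if "a \<in> S" for a using q[OF that] by (simp add: x_def)
  have w: "0 < w a" if "a \<in> S" for a using x[OF that] by (simp add: w_def)
  have wv: "(x a - 1)\<^sup>2 \<le> w a * v a" if "a \<in> S" for a
    using square_le_entropy_kernel[OF x[OF that]] by (simp add: w_def v_def)
  have v: "0 \<le> v a" if "a \<in> S" for a
    using wv[OF that] w[OF that] by (smt (verit) zero_le_power2 mult_pos_neg)
  have "(\<Sum>a\<in>S. \<bar>p a - q a\<bar>) \<le> (\<Sum>a\<in>S. sqrt (q a * w a) * sqrt (q a * v a))"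
  proof (rule sum_mono)
    fix a assume a: "a \<in> S"
    have "\<bar>p a - q a\<bar> = q a * \<bar>x a - 1\<bar>"
      using q[OF a] abs_mult[of "q a" "x a - 1"] by (simp add: px[OF a] right_diff_distrib)
    also have "\<dots> \<le> q a * sqrt (w a * v a)"
      using wv[OF a] q[OF a] by (intro mult_left_mono) (auto intro: real_le_rsqrt)
    also have "\<dots> = sqrt (q a * w a) * sqrt (q a * v a)"
      using q[OF a] by (simp add: real_sqrt_mult)
    finally show "\<bar>p a - q a\<bar> \<le> sqrt (q a * w a) * sqrt (q a * v a)" .
  qed
  then have "(\<Sum>a\<in>S. \<bar>p a - q a\<bar>)\<^sup>2 \<le> (\<Sum>a\<in>S. sqrt (q a * w a) * sqrt (q a * v a))\<^sup>2"
    by (intro power_mono sum_nonneg) auto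
  also have "\<dots> \<le> (\<Sum>a\<in>S. (sqrt (q a * w a))\<^sup>2) * (\<Sum>a\<in>S. (sqrt (q a * v a))\<^sup>2)"
    by (rule Cauchy_Schwarz_ineq_sum)
  also have "(\<Sum>a\<in>S. (sqrt (q a * w a))\<^sup>2) = (\<Sum>a\<in>S. 4/3 * q a + 2/3 * p a)"
  proof (intro sum.cong refl)
    fix a assume a: "a \<in> S"
    have "(sqrt (q a * w a))\<^sup>2 = q a * w a" using q[OF a] w[OF a] by simp
    then show "(sqrt (q a * w a))\<^sup>2 = 4/3 * q a + 2/3 * p a"
      by (simp add: w_def px[OF a] field_simps)
  qed
  also have "\<dots> = 2"
    unfolding sum.distrib sum_distrib_left[symmetric] sums by simp
  also have "(\<Sum>a\<in>S. (sqrt (q a * v a))\<^sup>2) = (\<Sum>a\<in>S. p a * ln (p a / q a) - p a + q a)"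
  proof (intro sum.cong refl)
    fix a assume a: "a \<in> S"
    have "(sqrt (q a * v a))\<^sup>2 = q a * v a" using q[OF a] v[OF a] by simp
    then show "(sqrt (q a * v a))\<^sup>2 = p a * ln (p a / q a) - p a + q a"
      using q[OF a] by (simp add: v_def px[OF a] algebra_simps)
  qed
  also have "\<dots> = rel_entropy S p q"
    by (simp add: rel_entropy_def sum.distrib sum_subtractf sums)
  finally show ?thesis .
qed

text \<open>Pinsker's inequality, scaled by n, bounds the deviation of the counts from n/k. The
  triangle inequality then moves the centre to x at a cost of |n/k - x| per cell. At x = m the
  right-hand side is the number whose floor is B.\<close>

lemma rel_entropy_le_imp_l1_le:
  fixes c :: "'a \<Rightarrow> nat"
  assumes S: "finite S" "card S = k" "0 < k" and n: "0 < n" "(\<Sum>a\<in>S. c a) = n"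
    and le: "rel_entropy S (empirical n c) (pmf (pmf_of_set S)) \<le> \<theta>"
  shows "(\<Sum>a\<in>S. \<bar>real (c a) - x\<bar>) \<le> real n * sqrt (2 * \<theta>) + real k * \<bar>real n / real k - x\<bar>"
proof -
  have ne: "S \<noteq> {}" using S by auto
  have q: "pmf (pmf_of_set S) a = 1 / real k" if "a \<in> S" for a
    using that S ne by simp
  have "(\<Sum>a\<in>S. \<bar>empirical n c a - pmf (pmf_of_set S) a\<bar>)\<^sup>2 \<le> 2 * rel_entropy S (empirical n c) (pmf (pmf_of_set S))"
  proof (rule pinsker)
    show "(\<Sum>a\<in>S. empirical n c a) = 1"
      using n by (simp add: empirical_def flip: sum_divide_distrib of_nat_sum)
  qed (use S q in \<open>auto simp: empirical_def\<close>)
  also have "\<dots> \<le> 2 * \<theta>" using le by simp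
  finally have "(\<Sum>a\<in>S. \<bar>empirical n c a - pmf (pmf_of_set S) a\<bar>) \<le> sqrt (2 * \<theta>)"
    by (rule real_le_rsqrt)
  then have "real n * (\<Sum>a\<in>S. \<bar>empirical n c a - pmf (pmf_of_set S) a\<bar>) \<le> real n * sqrt (2 * \<theta>)"
    by (rule mult_left_mono) simp
  also have "real n * (\<Sum>a\<in>S. \<bar>empirical n c a - pmf (pmf_of_set S) a\<bar>) = (\<Sum>a\<in>S. \<bar>real (c a) - real n / real k\<bar>)"
    unfolding sum_distrib_left
  proof (intro sum.cong refl)
    fix a assume "a \<in> S"
    have "real n * \<bar>real (c a) / real n - 1 / real k\<bar> = \<bar>real n * (real (c a) / real n - 1 / real k)\<bar>"
      by (simp add: abs_mult)
    also have "\<dots> = \<bar>real (c a) - real n / real k\<bar>"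
      using n by (simp add: right_diff_distrib)
    finally show "real n * \<bar>empirical n c a - pmf (pmf_of_set S) a\<bar> = \<bar>real (c a) - real n / real k\<bar>"
      using q[OF \<open>a \<in> S\<close>] by (simp add: empirical_def)
  qed
  finally have 1: "(\<Sum>a\<in>S. \<bar>real (c a) - real n / real k\<bar>) \<le> real n * sqrt (2 * \<theta>)" .
  have "(\<Sum>a\<in>S. \<bar>real (c a) - x\<bar>) \<le> (\<Sum>a\<in>S. \<bar>real (c a) - real n / real k\<bar> + \<bar>real n / real k - x\<bar>)"
    by (intro sum_mono) linarith
  also have "\<dots> = (\<Sum>a\<in>S. \<bar>real (c a) - real n / real k\<bar>) + real k * \<bar>real n / real k - x\<bar>"
    using S by (simp add: sum.distrib)
  finally show ?thesis using 1 by linarith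
qed

section \<open>Integer points on spheres\<close>

text \<open>Here \<open>- {0}\<close> is a complement: the support is all of T. These sets model the
  classes into which \<open>l1_sphere\<close> splits by support. Extensionality makes a vector
  determined by its coordinates in T.\<close>

definition nonzero_l1_sphere :: "'a set \<Rightarrow> nat \<Rightarrow> ('a \<Rightarrow> int) set" where
  "nonzero_l1_sphere T D = {f \<in> T \<rightarrow>\<^sub>E - {0}. (\<Sum>a\<in>T. \<bar>f a\<bar>) = int D}"

definition l1_sphere :: "'a set \<Rightarrow> nat \<Rightarrow> ('a \<Rightarrow> int) set" where
  "l1_sphere S D = {f \<in> S \<rightarrow>\<^sub>E UNIV. (\<Sum>a\<in>S. \<bar>f a\<bar>) = int D}"

text \<open>A vector on the larger set amounts to the norm i of its old part, the sign b of the new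
  coordinate and the old part itself. The new coordinate has absolute value D - i, and i < D because
  it is nonzero.\<close>

lemma nonzero_l1_sphere_insert:
  fixes D :: nat
  assumes "finite T" "x \<notin> T"
  defines "g \<equiv> \<lambda>(i, b, f). f(x := (if b then 1 else -1) * (int D - int i))"
  shows "bij_betw g (SIGMA i:{..<D}. UNIV \<times> nonzero_l1_sphere T i) (nonzero_l1_sphere (insert x T) D)"
  unfolding bij_betw_def
proof
  show "inj_on g (SIGMA i:{..<D}. UNIV \<times> nonzero_l1_sphere T i)"
  proof (rule inj_onI)
    fix u v assume u: "u \<in> (SIGMA i:{..<D}. UNIV \<times> nonzero_l1_sphere T i)"
      and v: "v \<in> (SIGMA i:{..<D}. UNIV \<times> nonzero_l1_sphere T i)" and eq: "g u = g v"
    obtain i b f where u': "u = (i, b, f)" by (cases u)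
    obtain j c h where v': "v = (j, c, h)" by (cases v)
    have "g u x = g v x" using eq by simp
    then have *: "i = j" "b = c"
      using u v unfolding u' v' g_def by (auto split: if_splits)
    have "f = (g u)(x := undefined)" "h = (g v)(x := undefined)"
      using u v assms(2) unfolding u' v' g_def
      by (auto simp: nonzero_l1_sphere_def PiE_def extensional_def fun_eq_iff)
    then show "u = v" using eq * u' v' by simp
  qed
  show "g ` (SIGMA i:{..<D}. UNIV \<times> nonzero_l1_sphere T i) = nonzero_l1_sphere (insert x T) D" (is "g ` ?A = ?B")
  proof (intro equalityI subsetI)
    fix h assume "h \<in> g ` ?A"
    then obtain i b f where i: "i < D" and f: "f \<in> nonzero_l1_sphere T i"
      and h: "h = f(x := (if b then 1 else -1) * (int D - int i))"
      by (auto simp: g_def)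
    have "(\<Sum>a\<in>T. \<bar>h a\<bar>) = (\<Sum>a\<in>T. \<bar>f a\<bar>)"
      using assms(2) h by (intro sum.cong) auto
    then have "(\<Sum>a\<in>insert x T. \<bar>h a\<bar>) = int D"
      using assms(1,2) i f by (simp add: h nonzero_l1_sphere_def)
    moreover have "h \<in> insert x T \<rightarrow>\<^sub>E - {0}"
      using f i by (auto simp: h nonzero_l1_sphere_def PiE_def extensional_def Pi_iff split: if_splits)
    ultimately show "h \<in> ?B" by (simp add: nonzero_l1_sphere_def)
  next
    fix h assume h: "h \<in> ?B"
    define f where "f = h(x := undefined)"
    define s where "s = (\<Sum>a\<in>T. \<bar>h a\<bar>)"
    have s: "0 \<le> s" "s + \<bar>h x\<bar> = int D" "h x \<noteq> 0"
      using h assms(1,2) by (auto simp: s_def nonzero_l1_sphere_def intro: sum_nonneg)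
    have "(\<Sum>a\<in>T. \<bar>f a\<bar>) = s"
      unfolding s_def using assms(2) f_def by (intro sum.cong) auto
    then have "f \<in> nonzero_l1_sphere T (nat s)"
      using h s assms(2) by (auto simp: nonzero_l1_sphere_def f_def PiE_def extensional_def)
    moreover have "h = g (nat s, 0 < h x, f)"
      using s by (auto simp: g_def f_def)
    moreover have "nat s < D" using s by linarith
    ultimately show "h \<in> g ` ?A" by blast
  qed
qed

text \<open>Signs times compositions of D into \<open>card T\<close> positive parts. The cases T =
  {} and D = 0 are separate because truncated subtraction would give wrong values: 1 for empty T and
  D > 0, and 2 for a singleton T and D = 0.\<close>

lemma card_nonzero_l1_sphere:
  assumes "finite T"
  shows "finite (nonzero_l1_sphere T D) \<and> card (nonzero_l1_sphere T D) =
    (if T = {} then (if D = 0 then 1 else 0)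
     else if D = 0 then 0 else 2 ^ card T * ((D - 1) choose (card T - 1)))"
  using assms
proof (induction T arbitrary: D rule: finite_induct)
  case empty
  have "nonzero_l1_sphere ({} :: 'a set) D = (if D = 0 then {\<lambda>_. undefined} else {})"
    by (auto simp: nonzero_l1_sphere_def)
  then show ?case by (cases "D = 0") simp_all
next
  case (insert x T)
  let ?A = "SIGMA i:{..<D}. (UNIV :: bool set) \<times> nonzero_l1_sphere T i"
  note bij = nonzero_l1_sphere_insert[OF insert.hyps, of D]
  have fin_T: "finite (nonzero_l1_sphere T i)" for i using insert.IH by blast
  then have "finite ?A" by auto
  then have fin: "finite (nonzero_l1_sphere (insert x T) D)"
    using bij_betw_finite[OF bij] by simp
  have "card (nonzero_l1_sphere (insert x T) D) = card ?A"
    using bij_betw_same_card[OF bij] by simp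
  also have "\<dots> = (\<Sum>i<D. 2 * card (nonzero_l1_sphere T i))"
    using fin_T by (subst card_SigmaI) (auto simp: card_cartesian_product)
  also have "\<dots> = (if D = 0 then 0 else 2 ^ card (insert x T) * ((D - 1) choose card T))"
  proof (cases D)
    case (Suc d)
    show ?thesis
    proof (cases "T = {}")
      case True
      then show ?thesis using insert.IH Suc by (simp add: sum.lessThan_Suc_shift del: sum.lessThan_Suc)
    next
      case False
      then obtain r where r: "card T = Suc r"
        using insert.hyps by (metis card_gt_0_iff gr0_conv_Suc)
      \<comment> \<open>The term at i = 0 vanishes since T is nonempty, and shifting the index turns
        i - 1 into i. What remains is the hockey-stick identity.\<close>
      have "(\<Sum>i<D. 2 * card (nonzero_l1_sphere T i)) = (\<Sum>i<d. 2 * (2 ^ card T * (i choose r)))"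
        using insert.IH False by (simp add: Suc sum.lessThan_Suc_shift r del: sum.lessThan_Suc)
      also have "\<dots> = 2 ^ Suc (card T) * (\<Sum>i<d. i choose r)"
        by (simp add: sum_distrib_left mult.assoc)
      also have "(\<Sum>i<d. i choose r) = d choose Suc r"
      proof (cases d)
        case (Suc e)
        then show ?thesis using sum_choose_upper[of r e] by (simp add: lessThan_Suc_atMost atLeast0AtMost)
      qed simp
      finally show ?thesis using Suc r insert.hyps by simp
    qed
  qed simp
  finally show ?case using fin insert.hyps by simp
qed

lemma sum_Pow_card:
  fixes h :: "nat \<Rightarrow> 'b::comm_semiring_1"
  assumes "finite S"
  shows "(\<Sum>T\<in>Pow S. h (card T)) = (\<Sum>r=0..card S. of_nat (card S choose r) * h r)"
proof -
  have "(\<Sum>T\<in>Pow S. h (card T)) = (\<Sum>r\<in>{0..card S}. \<Sum>T\<in>{T \<in> Pow S. card T = r}. h (card T))"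
    using assms by (intro sum.group[symmetric]) (auto intro: card_mono)
  also have "\<dots> = (\<Sum>r=0..card S. of_nat (card S choose r) * h r)"
    using n_subsets[OF assms] by (intro sum.cong refl) simp
  finally show ?thesis .
qed

text \<open>The sphere is partitioned by the support T, and restriction to T maps each class
  \<open>F T\<close> bijectively onto \<open>nonzero_l1_sphere T D\<close>. Supports are then
  collected by their size r; r = 0 contributes nothing because D > 0.\<close>

lemma card_l1_sphere:
  assumes "finite S" "0 < D"
  shows "finite (l1_sphere S D)"
    and "card (l1_sphere S D) = (\<Sum>r=1..card S. (card S choose r) * ((D - 1) choose (r - 1)) * 2 ^ r)"
proof -
  define F where "F T = {f \<in> l1_sphere S D. {a \<in> S. f a \<noteq> 0} = T}" for T
  have bij: "bij_betw (\<lambda>f. restrict f T) (F T) (nonzero_l1_sphere T D)" if T: "T \<subseteq> S" for T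
  proof (rule bij_betwI[where g = "\<lambda>f. restrict (\<lambda>a. if a \<in> T then f a else 0) S"])
    show "(\<lambda>f. restrict f T) \<in> F T \<rightarrow> nonzero_l1_sphere T D"
    proof
      fix f assume f: "f \<in> F T"
      have "(\<Sum>a\<in>T. \<bar>restrict f T a\<bar>) = (\<Sum>a\<in>T. \<bar>f a\<bar>)" by (intro sum.cong) auto
      also have "\<dots> = (\<Sum>a\<in>S. \<bar>f a\<bar>)"
        using f assms(1) T by (intro sum.mono_neutral_left) (auto simp: F_def)
      finally show "restrict f T \<in> nonzero_l1_sphere T D"
        using f by (auto simp: F_def nonzero_l1_sphere_def l1_sphere_def)
    qed
    show "(\<lambda>f. restrict (\<lambda>a. if a \<in> T then f a else 0) S) \<in> nonzero_l1_sphere T D \<rightarrow> F T"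
    proof
      fix f assume f: "f \<in> nonzero_l1_sphere T D"
      let ?f = "restrict (\<lambda>a. if a \<in> T then f a else 0) S"
      have "(\<Sum>a\<in>S. \<bar>?f a\<bar>) = (\<Sum>a\<in>T. \<bar>?f a\<bar>)"
        using assms(1) T by (intro sum.mono_neutral_right) auto
      also have "\<dots> = (\<Sum>a\<in>T. \<bar>f a\<bar>)"
        using T by (intro sum.cong) auto
      finally show "?f \<in> F T"
        using f T by (auto simp: F_def nonzero_l1_sphere_def l1_sphere_def PiE_def)
    qed
    show "restrict (\<lambda>a. if a \<in> T then restrict f T a else 0) S = f" if "f \<in> F T" for f
      using that by (auto simp: F_def l1_sphere_def PiE_def extensional_def fun_eq_iff)
    show "restrict (restrict (\<lambda>a. if a \<in> T then f a else 0) S) T = f" if "f \<in> nonzero_l1_sphere T D" for f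
      using that T by (auto simp: nonzero_l1_sphere_def PiE_def extensional_def fun_eq_iff)
  qed
  have finT: "finite T" if "T \<in> Pow S" for T
    using that assms(1) finite_subset by auto
  have finF: "finite (F T)" if "T \<in> Pow S" for T
    using bij_betw_finite[OF bij[of T]] that card_nonzero_l1_sphere[OF finT[OF that], of D] by simp
  have cardF: "card (F T) = (if card T = 0 then 0 else 2 ^ card T * ((D - 1) choose (card T - 1)))"
    if "T \<in> Pow S" for T
  proof -
    have "card (F T) = card (nonzero_l1_sphere T D)"
      using bij_betw_same_card[OF bij[of T]] that by simp
    then show ?thesis
      using card_nonzero_l1_sphere[OF finT[OF that], of D] assms(2) finT[OF that] by simp
  qed
  have U: "l1_sphere S D = (\<Union>T\<in>Pow S. F T)"
  proof (intro equalityI subsetI)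
    fix f assume "f \<in> l1_sphere S D"
    then have "f \<in> F {a \<in> S. f a \<noteq> 0}" by (simp add: F_def)
    then show "f \<in> (\<Union>T\<in>Pow S. F T)" by (intro UN_I[where a = "{a \<in> S. f a \<noteq> 0}"]) auto
  next
    fix f assume "f \<in> (\<Union>T\<in>Pow S. F T)"
    then obtain T where "f \<in> F T" by (rule UN_E)
    then show "f \<in> l1_sphere S D" unfolding F_def by simp
  qed
  show "finite (l1_sphere S D)"
    unfolding U using finF assms(1) by blast
  have "card (l1_sphere S D) = (\<Sum>T\<in>Pow S. card (F T))"
    unfolding U using finF assms(1) by (intro card_UN_disjoint) (auto simp: F_def)
  also have "\<dots> = (\<Sum>T\<in>Pow S. if card T = 0 then 0 else 2 ^ card T * ((D - 1) choose (card T - 1)))"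
    by (intro sum.cong refl cardF)
  also have "\<dots> = (\<Sum>r=0..card S. (card S choose r) * (if r = 0 then 0 else 2 ^ r * ((D - 1) choose (r - 1))))"
    using sum_Pow_card[OF assms(1), of "\<lambda>r. if r = 0 then 0 else 2 ^ r * ((D - 1) choose (r - 1))"]
    by simp
  also have "\<dots> = (\<Sum>r=1..card S. (card S choose r) * ((D - 1) choose (r - 1)) * 2 ^ r)"
    by (simp add: sum.atLeast_Suc_atMost mult_ac)
  finally show "card (l1_sphere S D) = (\<Sum>r=1..card S. (card S choose r) * ((D - 1) choose (r - 1)) * 2 ^ r)" .
qed

section \<open>The multinomial distribution\<close>

text \<open>After taking logarithms, the parabola at x = d/m is multiplied by c + 1/2 = m + d + 1/2,
  where d = c - m. In the product, the linear part has a sum fixed by n, \<open>Q\<close> is the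
  coefficient of d^2, and the cubic coefficient is -A/m^2.\<close>

lemma multinomial_term_bound:
  fixes c :: "'a \<Rightarrow> nat" and m n k D :: nat
  assumes S: "finite S" "card S = k" "0 < k" and n: "0 < n" "(\<Sum>a\<in>S. c a) = n"
    and D: "(\<Sum>a\<in>S. \<bar>int (c a) - int m\<bar>) = int D" "0 < D" "D < m"
    and cond: "2 * c_coeff m D \<ge> - ((2 * real m - 1) / (2 * real m + 1))"
    and \<mu>: "\<mu> = real n / real k"
  shows "fact n / (\<Prod>a\<in>S. fact (c a)) * (\<Prod>a\<in>S. (1 / real k) ^ c a)
    < sqrt (2 * pi * real n) * \<mu> ^ n / ((2 * pi * real m) powr (real k / 2) * real m ^ n)
      * exp (1 / (12 * real n) + real k * (real m - \<mu>) * (1 + 1 / (2 * real m)))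
      * exp ((1/2 - c_coeff m D) / (real m)\<^sup>2 * real D ^ 3
             - ((1/2 + c_coeff m D) / real m - (1/2 - c_coeff m D) / (2 * (real m)\<^sup>2)) * real D)"
    (is "?L < ?R")
proof -
  define A where "A = 1/2 - c_coeff m D"
  define Q where "Q = (1/2 + c_coeff m D) / real m - (1/2 - c_coeff m D) / (2 * (real m)\<^sup>2)"
  define d where "d a = real (c a) - real m" for a
  have m: "0 < real m" using D by simp
  have A: "0 \<le> A" using c_coeff_le_half[of D m] D by (simp add: A_def)
  have QA: "Q = (1 - A) / real m - A / (2 * (real m)\<^sup>2)"
    by (simp add: Q_def A_def)
  \<comment> \<open>With A = 1/2 - \<open>c_coeff m D\<close>, the hypothesis \<open>cond\<close>
    says A <= 2m (1 - A), which is equivalent to Q >= 0.\<close>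
  have Q: "0 \<le> Q"
  proof -
    have "2 * c_coeff m D * (2 * real m + 1) \<ge> - (2 * real m - 1)"
      using cond by (simp add: field_simps)
    then have "A \<le> (1 - A) * (2 * real m)" by (simp add: A_def algebra_simps)
    then have "A * real m \<le> (1 - A) * (2 * real m) * real m"
      using m by (intro mult_right_mono) auto
    then show ?thesis using m by (simp add: QA field_simps power2_eq_square)
  qed
  have sum_d: "(\<Sum>a\<in>S. \<bar>d a\<bar>) = real D"
  proof -
    have "(\<Sum>a\<in>S. \<bar>d a\<bar>) = real_of_int (\<Sum>a\<in>S. \<bar>int (c a) - int m\<bar>)"
      by (simp add: d_def)
    then show ?thesis using D by simp
  qed
  have d_le: "\<bar>d a\<bar> \<le> real D" if "a \<in> S" for a
    using member_le_sum[of a S "\<lambda>a. \<bar>d a\<bar>"] that S sum_d by simp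
  \<comment> \<open>Every count differs from m by at most D < m, so the Stirling bound applies to
    each cell.\<close>
  have c_pos: "0 < c a" if "a \<in> S" for a
    using d_le[OF that] D by (cases "c a") (auto simp: d_def)
  \<comment> \<open>Quadratic and cubic terms are reduced to multiples of |d|, so that summing over
    S requires only \<open>sum_d\<close> and \<open>sum_d'\<close>.\<close>
  have term_ge: "ln (2 * pi) / 2 + (real (c a) + 1/2) * ln (real m) + d a * (1 + 1 / (2 * real m)) + Q * \<bar>d a\<bar>
      - A / (real m)\<^sup>2 * (\<bar>d a\<bar> * (real D)\<^sup>2) - real (c a) < ln (fact (c a))" if a: "a \<in> S" for a
  proof -
    have c: "real (c a) = real m + d a" by (simp add: d_def)
    have "d a / real m - A * (d a / real m)\<^sup>2 \<le> ln (1 + d a / real m)"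
      using D d_le[OF a] ln_one_minus_eq_c_coeff[of D m]
      by (intro ln_ge_parabola[where y = "D / m"]) (auto simp: A_def field_simps)
    also have "ln (1 + d a / real m) = ln (real (c a) / real m)"
      using m by (simp add: d_def field_simps)
    also have "\<dots> = ln (real (c a)) - ln (real m)"
      using m c_pos[OF a] by (simp add: ln_div)
    finally have "(real (c a) + 1/2) * (d a / real m - A * (d a / real m)\<^sup>2)
        \<le> (real (c a) + 1/2) * (ln (real (c a)) - ln (real m))"
      by (intro mult_left_mono) auto
    also have "(real (c a) + 1/2) * (d a / real m - A * (d a / real m)\<^sup>2)
       = d a * (1 + 1 / (2 * real m)) + Q * (d a)\<^sup>2 - A / (real m)\<^sup>2 * (d a) ^ 3"
      using m unfolding c QA by (simp add: field_simps power2_eq_square power3_eq_cube)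
    finally have 1: "d a * (1 + 1 / (2 * real m)) + Q * (d a)\<^sup>2 - A / (real m)\<^sup>2 * (d a) ^ 3
       \<le> (real (c a) + 1/2) * ln (real (c a)) - (real (c a) + 1/2) * ln (real m)"
      by (simp add: algebra_simps)
    \<comment> \<open>This holds because d is an integer.\<close>
    have "\<bar>d a\<bar> \<le> (d a)\<^sup>2"
    proof -
      have "\<bar>int (c a) - int m\<bar> \<le> (int (c a) - int m)\<^sup>2"
      proof (cases "int (c a) - int m = 0")
        case False
        then have "1 \<le> \<bar>int (c a) - int m\<bar>" by linarith
        then have "\<bar>int (c a) - int m\<bar> ^ 1 \<le> \<bar>int (c a) - int m\<bar>\<^sup>2"
          by (intro power_increasing) auto
        then show ?thesis by simp
      qed simp
      then have "real_of_int \<bar>int (c a) - int m\<bar> \<le> real_of_int ((int (c a) - int m)\<^sup>2)"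
        by (rule of_int_le_iff[THEN iffD2])
      then show ?thesis by (simp add: d_def)
    qed
    then have 2: "Q * \<bar>d a\<bar> \<le> Q * (d a)\<^sup>2" using Q by (rule mult_left_mono)
    have "(d a) ^ 3 \<le> \<bar>d a\<bar> * \<bar>d a\<bar>\<^sup>2"
      using abs_ge_self[of "d a ^ 3"] by (simp add: power_abs power3_eq_cube power2_eq_square abs_mult)
    also have "\<dots> \<le> \<bar>d a\<bar> * (real D)\<^sup>2"
      using d_le[OF a] by (intro mult_left_mono power_mono) auto
    finally have 3: "A / (real m)\<^sup>2 * (d a) ^ 3 \<le> A / (real m)\<^sup>2 * (\<bar>d a\<bar> * (real D)\<^sup>2)"
      using A by (intro mult_left_mono) auto
    have "ln (2 * pi) / 2 < ln (fact (c a)) - (real (c a) + 1/2) * ln (real (c a)) + real (c a)"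
      using stirling_err_bounds(1)[OF c_pos[OF a]] by (simp add: stirling_err_def)
    with 1 2 3 show ?thesis by linarith
  qed
  have sum_d': "(\<Sum>a\<in>S. d a) = - (real k * (real m - \<mu>))"
    using n S \<mu> by (simp add: d_def sum_subtractf algebra_simps flip: of_nat_sum)
  have "real k * (ln (2 * pi) / 2) + (real n + real k / 2) * ln (real m)
      - real k * (real m - \<mu>) * (1 + 1 / (2 * real m)) + Q * real D
      - A / (real m)\<^sup>2 * real D ^ 3 - real n
    = (\<Sum>a\<in>S. ln (2 * pi) / 2 + (real (c a) + 1/2) * ln (real m) + d a * (1 + 1 / (2 * real m)) + Q * \<bar>d a\<bar>
      - A / (real m)\<^sup>2 * (\<bar>d a\<bar> * (real D)\<^sup>2) - real (c a))"
    using n S by (simp only: sum.distrib sum_subtractf flip: sum_distrib_left sum_distrib_right of_nat_sum)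
      (simp add: sum_d sum_d' power3_eq_cube power2_eq_square)
  also have "\<dots> < (\<Sum>a\<in>S. ln (fact (c a)))"
    using S by (intro sum_strict_mono term_ge) auto
  finally have lnc: "real k * (ln (2 * pi) / 2) + (real n + real k / 2) * ln (real m)
      - real k * (real m - \<mu>) * (1 + 1 / (2 * real m)) + Q * real D
      - A / (real m)\<^sup>2 * real D ^ 3 - real n < (\<Sum>a\<in>S. ln (fact (c a)))" .
  have lnn: "ln (fact n) \<le> ln (2 * pi) / 2 + 1 / (12 * real n) + (real n + 1/2) * ln (real n) - real n"
    using stirling_err_bounds(2)[OF n(1)] by (simp add: stirling_err_def)
  have \<mu>_pos: "0 < \<mu>" using \<mu> n S by simp
  have prod_k: "(\<Prod>a\<in>S. (1 / real k) ^ c a) = (1 / real k) ^ n"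
    by (simp add: n flip: power_sum)
  have Lpos: "0 < ?L" using S by (auto intro!: divide_pos_pos mult_pos_pos prod_pos)
  have Rpos: "0 < ?R" using m \<mu>_pos n by (auto intro!: divide_pos_pos mult_pos_pos)
  have ln_L: "ln ?L = ln (fact n) - (\<Sum>a\<in>S. ln (fact (c a))) - real n * ln (real k)"
  proof -
    have "0 < (\<Prod>a\<in>S. fact (c a) :: real)" by (intro prod_pos) auto
    moreover have "ln (\<Prod>a\<in>S. fact (c a) :: real) = (\<Sum>a\<in>S. ln (fact (c a)))"
      using S by (intro ln_prod) auto
    ultimately show ?thesis
      unfolding prod_k using S by (simp add: ln_mult ln_div ln_realpow)
  qed
  have ln_R: "ln ?R = (ln (2 * pi) + ln (real n)) / 2 + real n * (ln (real n) - ln (real k))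
      - real k / 2 * (ln (2 * pi) + ln (real m)) - real n * ln (real m)
      + (1 / (12 * real n) + real k * (real m - \<mu>) * (1 + 1 / (2 * real m)))
      + (A / (real m)\<^sup>2 * real D ^ 3 - Q * real D)"
  proof -
    have 1: "ln (sqrt (2 * pi * real n)) = (ln (2 * pi) + ln (real n)) / 2"
      using n ln_mult[of "2 * pi" "real n"] by (simp add: ln_sqrt)
    have 2: "ln (\<mu> ^ n) = real n * (ln (real n) - ln (real k))"
      unfolding \<mu> using n S by (simp add: ln_realpow ln_div)
    have 3: "ln ((2 * pi * real m) powr (real k / 2)) = real k / 2 * (ln (2 * pi) + ln (real m))"
      using m ln_mult[of "2 * pi" "real m"] by (simp add: ln_powr)
    have 4: "ln (real m ^ n) = real n * ln (real m)"
      by (simp add: ln_realpow m)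
    have pos: "0 < sqrt (2 * pi * real n)" "0 < \<mu> ^ n" "0 < (2 * pi * real m) powr (real k / 2)" "0 < real m ^ n"
      using n m \<mu>_pos by auto
    have "ln (x * y / (z * w) * exp u * exp v) = ln x + ln y - ln z - ln w + u + v"
      if "0 < x" "0 < y" "0 < z" "0 < w" for x y z w u v :: real
      using that by (simp add: ln_mult ln_div)
    from this[OF pos] show ?thesis
      unfolding 1 2 3 4 A_def Q_def by simp
  qed
  \<comment> \<open>The comparison is stated for arbitrary reals, so that the composite terms of
    \<open>lnc\<close> and \<open>lnn\<close> are treated as atoms.\<close>
  have "x - C - real n * ln (real k) < (p + ln (real n)) / 2 + real n * (ln (real n) - ln (real k))
      - real k / 2 * (p + ln (real m)) - real n * ln (real m) + (e + w) + (u - v)"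
    if "real k * (p / 2) + (real n + real k / 2) * ln (real m) - w + v - u - real n < C"
      and "x \<le> p / 2 + e + (real n + 1/2) * ln (real n) - real n" for x C p e w u v
    using that by (simp add: field_simps)
  from this[OF lnc lnn] have "ln ?L < ln ?R" unfolding ln_L ln_R .
  then show ?thesis using Lpos Rpos by simp
qed

section \<open>From point probabilities to probabilities of events\<close>

lemma multinomial_event_measurable:
  assumes "finite S" "multinomially_distributed M N S n p"
  shows "{\<omega> \<in> space M. \<forall>a\<in>S. N \<omega> a = c a} \<in> sets M"
proof -
  have [measurable]: "(\<lambda>\<omega>. N \<omega> a) \<in> measurable M (count_space UNIV)" if "a \<in> S" for a
    using assms(2) that by (simp add: multinomially_distributed_def)
  show ?thesis using assms(1) by measurable
qed

text \<open>Each vector of wrong total has probability 0, and since S is finite there are only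
  countably many count vectors on S.\<close>

lemma multinomial_AE_sum:
  assumes "prob_space M" "finite S" "multinomially_distributed M N S n p"
  shows "AE \<omega> in M. (\<Sum>a\<in>S. N \<omega> a) = n"
proof -
  interpret prob_space M by fact
  define Ev where "Ev c = {\<omega> \<in> space M. \<forall>a\<in>S. N \<omega> a = c a}" for c
  define Z where "Z = {c \<in> S \<rightarrow>\<^sub>E UNIV. (\<Sum>a\<in>S. c a) \<noteq> n}"
  have meas: "Ev c \<in> sets M" for c
    unfolding Ev_def using assms(2,3) by (rule multinomial_event_measurable)
  have "countable (S \<rightarrow>\<^sub>E (UNIV :: nat set))"
    using assms(2) by (intro countable_PiE) auto
  then have "countable Z"
    by (rule countable_subset[rotated]) (auto simp: Z_def)
  moreover have "AE \<omega> in M. \<omega> \<notin> Ev c" if "c \<in> Z" for c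
  proof -
    have "measure M (Ev c) = 0"
      using assms(3) that by (simp add: multinomially_distributed_def Ev_def Z_def)
    then have "Ev c \<in> null_sets M"
      using meas[of c] by (simp add: null_sets_def emeasure_eq_measure)
    then show ?thesis by (rule AE_not_in)
  qed
  ultimately have "AE \<omega> in M. \<forall>c\<in>Z. \<omega> \<notin> Ev c"
    by (subst AE_ball_countable) auto
  with AE_space show ?thesis
  proof eventually_elim
    case (elim \<omega>)
    show ?case
    proof (rule ccontr)
      assume "(\<Sum>a\<in>S. N \<omega> a) \<noteq> n"
      then have "restrict (N \<omega>) S \<in> Z" by (simp add: Z_def)
      moreover have "\<omega> \<in> Ev (restrict (N \<omega>) S)" using elim by (simp add: Ev_def)
      ultimately show False using elim by blast
    qed
  qed
qed

text \<open>A union bound over the point events of C. The inclusion holds only almost surely, since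
  other totals are excluded up to a null set. Restriction to S makes the counts extensional, as the
  members of C are to be.\<close>

lemma prob_multinomial_le_sum:
  assumes "prob_space M" "finite S" "multinomially_distributed M N S n p" "finite C"
    and C: "\<And>c. c \<in> S \<rightarrow>\<^sub>E UNIV \<Longrightarrow> (\<Sum>a\<in>S. c a) = n \<Longrightarrow> P c \<Longrightarrow> c \<in> C"
      "\<And>c. c \<in> C \<Longrightarrow> (\<Sum>a\<in>S. c a) = n"
  shows "measure M {\<omega> \<in> space M. P (restrict (N \<omega>) S)}
    \<le> (\<Sum>c\<in>C. fact n / (\<Prod>a\<in>S. fact (c a)) * (\<Prod>a\<in>S. p a ^ c a))"
proof -
  interpret prob_space M by fact
  define Ev where "Ev c = {\<omega> \<in> space M. \<forall>a\<in>S. N \<omega> a = c a}" for c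
  have meas: "Ev c \<in> sets M" for c
    unfolding Ev_def using assms(2,3) by (rule multinomial_event_measurable)
  have "measure M {\<omega> \<in> space M. P (restrict (N \<omega>) S)} \<le> measure M (\<Union>c\<in>C. Ev c)"
  proof (rule finite_measure_mono_AE)
    show "AE \<omega> in M. \<omega> \<in> {\<omega> \<in> space M. P (restrict (N \<omega>) S)} \<longrightarrow> \<omega> \<in> (\<Union>c\<in>C. Ev c)"
      using multinomial_AE_sum[OF assms(1-3)]
    proof eventually_elim
      case (elim \<omega>)
      show ?case
      proof
        assume \<omega>: "\<omega> \<in> {\<omega> \<in> space M. P (restrict (N \<omega>) S)}"
        then have "restrict (N \<omega>) S \<in> C" using elim by (intro C(1)) auto
        moreover have "\<omega> \<in> Ev (restrict (N \<omega>) S)" using \<omega> by (simp add: Ev_def)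
        ultimately show "\<omega> \<in> (\<Union>c\<in>C. Ev c)" by blast
      qed
    qed
    show "(\<Union>c\<in>C. Ev c) \<in> sets M" using meas assms(4) by auto
  qed
  also have "\<dots> \<le> (\<Sum>c\<in>C. measure M (Ev c))"
    using meas assms(4) by (intro finite_measure_subadditive_finite) auto
  also have "\<dots> = (\<Sum>c\<in>C. fact n / (\<Prod>a\<in>S. fact (c a)) * (\<Prod>a\<in>S. p a ^ c a))"
    using assms(3) C(2) by (intro sum.cong refl) (simp add: multinomially_distributed_def Ev_def)
  finally show ?thesis .
qed

section \<open>Summation over the spheres around the constant vector\<close>

theorem theorem1:
  fixes S :: "'a set" and k n :: nat
    and M :: "'w measure" and N :: "'w \<Rightarrow> 'a \<Rightarrow> nat"
    and \<mu> \<theta> :: real and m B :: int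
  assumes "finite S" and "card S = k" and "k \<ge> 2" and "n \<ge> 2"
    and "prob_space M"
    and "multinomially_distributed M N S n (\<lambda>_. 1 / real k)"
    and "\<mu> = real n / real k"
    and "nearest_int \<mu> m"
    and "\<theta> > 0"
    and "B = \<lfloor>real n * sqrt (2 * \<theta>) + real k * \<bar>\<mu> - real_of_int m\<bar>\<rfloor>"
    and "0 < B" and "B < m"
    and "2 * c_coeff (real_of_int m) (real_of_int B)
           > - ((2 * real_of_int m - 1) / (2 * real_of_int m + 1))"
  shows "measure M {\<omega> \<in> space M.
             rel_entropy S (empirical n (N \<omega>)) (pmf (pmf_of_set S)) \<le> \<theta>}
    < sqrt (2 * pi * real n) * \<mu> ^ n
        / ((2 * pi * real_of_int m) powr (real k / 2) * real_of_int m ^ n)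
      * exp (1 / (12 * real n)
             + real k * (real_of_int m - \<mu>) * (1 + 1 / (2 * real_of_int m)))
      * (\<Sum>\<Delta> = 1..nat B.
           exp ((1/2 - c_coeff (real_of_int m) (real \<Delta>)) / (real_of_int m)\<^sup>2 * real \<Delta> ^ 3
                - ((1/2 + c_coeff (real_of_int m) (real \<Delta>)) / real_of_int m
                   - (1/2 - c_coeff (real_of_int m) (real \<Delta>)) / (2 * (real_of_int m)\<^sup>2))
                  * real \<Delta>)
           * (\<Sum>r = 1..k. real (k choose r) * real ((\<Delta> - 1) choose (r - 1)) * 2 ^ r))
      + 1 / real k ^ n
        * (if \<mu> \<in> \<int> then fact n / fact (nat \<lfloor>\<mu>\<rfloor>) ^ k else 0)"
proof -
  define l where "l = nat m"
  define b where "b = nat B"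
  have m: "real_of_int m = real l" and l: "b < l" and b: "0 < b" "real_of_int B = real b"
    using assms(11,12) by (auto simp: l_def b_def)
  define K where "K = sqrt (2 * pi * real n) * \<mu> ^ n / ((2 * pi * real l) powr (real k / 2) * real l ^ n)
    * exp (1 / (12 * real n) + real k * (real l - \<mu>) * (1 + 1 / (2 * real l)))"
  define E where "E D = exp ((1/2 - c_coeff l (real D)) / (real l)\<^sup>2 * real D ^ 3
      - ((1/2 + c_coeff l (real D)) / real l - (1/2 - c_coeff l (real D)) / (2 * (real l)\<^sup>2)) * real D)" for D
  define R where "R D = (\<Sum>r = 1..k. real (k choose r) * real ((D - 1) choose (r - 1)) * 2 ^ r)" for D
  define Pr where "Pr c = fact n / (\<Prod>a\<in>S. fact (c a)) * (\<Prod>a\<in>S. (1 / real k) ^ c a)" for c :: "'a \<Rightarrow> nat"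
  define dev where "dev c = nat (\<Sum>a\<in>S. \<bar>int (c a) - int l\<bar>)" for c :: "'a \<Rightarrow> nat"
  define C where "C = {c \<in> S \<rightarrow>\<^sub>E UNIV. (\<Sum>a\<in>S. c a) = n \<and> dev c \<le> b}"
  have int_dev: "int (dev c) = (\<Sum>a\<in>S. \<bar>int (c a) - int l\<bar>)" for c
    by (simp add: dev_def sum_nonneg)
  have finC: "finite C"
  proof (rule finite_subset)
    show "C \<subseteq> S \<rightarrow>\<^sub>E {..n}"
    proof
      fix c assume c: "c \<in> C"
      have "c a \<le> n" if "a \<in> S" for a
        using member_le_sum[of a S c] that assms(1) c by (simp add: C_def)
      then show "c \<in> S \<rightarrow>\<^sub>E {..n}" using c by (simp add: C_def PiE_iff)
    qed
  qed (use assms(1) in \<open>auto intro: finite_PiE\<close>)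
  have R_card: "R D = real (card (l1_sphere S D))" if "0 < D" for D
    using card_l1_sphere(2)[OF assms(1) that] by (simp add: R_def assms(2))
  have R_pos: "0 < R D" if "0 < D" for D
    unfolding R_def using assms(3) by (intro sum_pos2[where i = 1]) auto
  have K_pos: "0 < K" and E_pos: "0 < E D" for D
    using assms(3,4,7) l by (auto simp: K_def E_def intro!: mult_pos_pos divide_pos_pos)
  \<comment> \<open>An empty shell is treated separately: there the strict inequality comes from
    positivity of the right-hand side.\<close>
  have shell: "(\<Sum>c\<in>{c \<in> C. dev c = D}. Pr c) < K * E D * R D" if D: "D \<in> {1..b}" for D
  proof (cases "{c \<in> C. dev c = D} = {}")
    case True
    then show ?thesis using K_pos E_pos[of D] R_pos[of D] D by (simp only: sum.empty) simp
  next
    case False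
    have "Pr c < K * E D" if c: "c \<in> {c \<in> C. dev c = D}" for c
      unfolding Pr_def K_def E_def
    proof (rule multinomial_term_bound)
      show "(\<Sum>a\<in>S. \<bar>int (c a) - int l\<bar>) = int D"
        using c int_dev[of c] by simp
      \<comment> \<open>Monotonicity carries the hypothesis at B over to every radius D <=
        B.\<close>
      have "c_coeff (real l) (real b) \<le> c_coeff (real l) (real D)"
        using D l by (intro c_coeff_antimono) auto
      then show "2 * c_coeff (real l) (real D) \<ge> - ((2 * real l - 1) / (2 * real l + 1))"
        using assms(13) unfolding m b(2) by linarith
    qed (use assms D l c in \<open>auto simp: C_def\<close>)
    then have "(\<Sum>c\<in>{c \<in> C. dev c = D}. Pr c) < (\<Sum>c\<in>{c \<in> C. dev c = D}. K * E D)"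
      using finC False by (intro sum_strict_mono) auto
    also have "\<dots> = K * E D * real (card {c \<in> C. dev c = D})" by simp
    also have "\<dots> \<le> K * E D * R D"
    proof -
      \<comment> \<open>Translation by the constant vector embeds the shell into the sphere. Only an
        inequality results, since members of C also have total n and nonnegative entries.\<close>
      have "card {c \<in> C. dev c = D} \<le> card (l1_sphere S D)"
      proof (rule card_inj_on_le[where f = "\<lambda>c. restrict (\<lambda>a. int (c a) - int l) S"])
        show "inj_on (\<lambda>c. restrict (\<lambda>a. int (c a) - int l) S) {c \<in> C. dev c = D}"
        proof (rule inj_onI)
          fix c c' assume c: "c \<in> {c \<in> C. dev c = D}" "c' \<in> {c \<in> C. dev c = D}"
            and eq: "restrict (\<lambda>a. int (c a) - int l) S = restrict (\<lambda>a. int (c' a) - int l) S"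
          have "c a = c' a" if "a \<in> S" for a
            using fun_cong[OF eq, of a] that by simp
          then show "c = c'" using c by (intro PiE_ext[of c S "\<lambda>_. UNIV" c']) (auto simp: C_def)
        qed
        show "(\<lambda>c. restrict (\<lambda>a. int (c a) - int l) S) ` {c \<in> C. dev c = D} \<subseteq> l1_sphere S D"
          by (auto simp: l1_sphere_def int_dev)
      qed (use card_l1_sphere(1)[OF assms(1)] D in simp)
      then show ?thesis
        using R_card[of D] D K_pos E_pos[of D] by (intro mult_left_mono) auto
    qed
    finally show ?thesis .
  qed
  \<comment> \<open>At distance 0 only the constant vector l is possible. It has total n exactly if
    n = k l, and then \<mu> = l is an integer.\<close>
  have center: "(\<Sum>c\<in>{c \<in> C. dev c = 0}. Pr c)
      \<le> 1 / real k ^ n * (if \<mu> \<in> \<int> then fact n / fact (nat \<lfloor>\<mu>\<rfloor>) ^ k else 0)"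
  proof (cases "{c \<in> C. dev c = 0} = {}")
    case True
    then show ?thesis by (simp only: sum.empty) simp
  next
    case False
    have eq_l: "c a = l" if "c \<in> {c \<in> C. dev c = 0}" "a \<in> S" for c a
    proof -
      have "(\<Sum>a\<in>S. \<bar>int (c a) - int l\<bar>) = 0" using that int_dev[of c] by simp
      then show ?thesis using that assms(1) by (subst (asm) sum_nonneg_eq_0_iff) auto
    qed
    obtain c where c: "c \<in> {c \<in> C. dev c = 0}" using False by blast
    have uniq: "c' = c" if c': "c' \<in> {c \<in> C. dev c = 0}" for c'
    proof (rule PiE_ext)
      show "c' \<in> S \<rightarrow>\<^sub>E UNIV" "c \<in> S \<rightarrow>\<^sub>E UNIV" using c c' by (simp_all add: C_def)
      show "c' a = c a" if "a \<in> S" for a using eq_l[OF c' that] eq_l[OF c that] by simp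
    qed
    have single: "{c \<in> C. dev c = 0} = {c}"
    proof (intro equalityI subsetI)
      fix c' assume "c' \<in> {c \<in> C. dev c = 0}"
      from uniq[OF this] show "c' \<in> {c}" by simp
    next
      fix c' assume "c' \<in> {c}"
      then show "c' \<in> {c \<in> C. dev c = 0}" using c by (simp only: singleton_iff)
    qed
    have "n = (\<Sum>a\<in>S. c a)" using c by (simp add: C_def)
    also have "\<dots> = k * l" using eq_l[OF c] assms(2) by simp
    finally have n: "n = k * l" .
    have \<mu>: "\<mu> = real l" using n assms(3,7) by simp
    have "Pr c = fact n / fact l ^ k * (1 / real k) ^ n"
    proof -
      have "(\<Prod>a\<in>S. fact (c a) :: real) = (\<Prod>a\<in>S. fact l)"
        using eq_l[OF c] by (intro prod.cong) auto
      moreover have "(\<Prod>a\<in>S. (1 / real k) ^ c a) = (\<Prod>a\<in>S. (1 / real k) ^ l)"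
        using eq_l[OF c] by (intro prod.cong) auto
      ultimately show ?thesis
        using assms(2) unfolding n by (simp only: Pr_def prod_constant power_mult[symmetric] mult.commute n)
    qed
    then show ?thesis
      unfolding single by (simp add: \<mu> power_divide mult.commute)
  qed
  \<comment> \<open>The relative entropy reads only coordinates in S, so the counts may be replaced
    by their restriction.\<close>
  have "measure M {\<omega> \<in> space M. rel_entropy S (empirical n (N \<omega>)) (pmf (pmf_of_set S)) \<le> \<theta>}
    = measure M {\<omega> \<in> space M. rel_entropy S (empirical n (restrict (N \<omega>) S)) (pmf (pmf_of_set S)) \<le> \<theta>}"
    by (simp add: rel_entropy_def empirical_def)
  also have "\<dots> \<le> (\<Sum>c\<in>C. Pr c)"
    unfolding Pr_def
  proof (rule prob_multinomial_le_sum[OF assms(5,1,6) finC])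
    fix c :: "'a \<Rightarrow> nat" assume c: "c \<in> S \<rightarrow>\<^sub>E UNIV" "(\<Sum>a\<in>S. c a) = n"
      and le: "rel_entropy S (empirical n c) (pmf (pmf_of_set S)) \<le> \<theta>"
    have "real_of_int (int (dev c)) = (\<Sum>a\<in>S. \<bar>real (c a) - real l\<bar>)"
      unfolding int_dev by simp
    also have "\<dots> \<le> real n * sqrt (2 * \<theta>) + real k * \<bar>\<mu> - real l\<bar>"
      unfolding assms(7) using assms c le by (intro rel_entropy_le_imp_l1_le) auto
    \<comment> \<open>The distance is an integer, so the real bound may be rounded down to
      B.\<close>
    finally have "int (dev c) \<le> B"
      unfolding assms(10) m by (simp only: le_floor_iff)
    then show "c \<in> C" using c by (simp add: C_def b_def)
  qed (simp add: C_def)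
  also have "(\<Sum>c\<in>C. Pr c) = (\<Sum>D\<in>{0..b}. \<Sum>c\<in>{c \<in> C. dev c = D}. Pr c)"
    using finC by (intro sum.group[symmetric]) (auto simp: C_def)
  also have "\<dots> = (\<Sum>c\<in>{c \<in> C. dev c = 0}. Pr c) + (\<Sum>D = 1..b. \<Sum>c\<in>{c \<in> C. dev c = D}. Pr c)"
    by (simp add: sum.atLeast_Suc_atMost)
  \<comment> \<open>The central term contributes only a weak inequality; strictness comes from the
    shells, of which there is at least one because b > 0.\<close>
  also have "\<dots> < 1 / real k ^ n * (if \<mu> \<in> \<int> then fact n / fact (nat \<lfloor>\<mu>\<rfloor>) ^ k else 0)
      + (\<Sum>D = 1..b. K * E D * R D)"
    using b by (intro add_le_less_mono center sum_strict_mono shell) auto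
  also have "\<dots> = K * (\<Sum>D = 1..b. E D * R D)
      + 1 / real k ^ n * (if \<mu> \<in> \<int> then fact n / fact (nat \<lfloor>\<mu>\<rfloor>) ^ k else 0)"
    by (simp add: sum_distrib_left mult.assoc)
  finally show ?thesis
    unfolding K_def E_def R_def m b_def .
qed

end
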